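(* For any $h\in B_c$, consider the maximization problem $$\sup_{\lambda\in\Lambda}\ L(\lambda,h):=2\,l(\lambda)-\langle\lambda,\phi(h)\rangle .$$ The following assertions hold. (i) The maximization problem is bounded (has finite supremum) if and only if $h\in\mathcal{K}(\epsilon)$, and then the maximal value is equal to $\eta(h)$; in other words, $\eta(h)=\sup_{\lambda\in\Lambda}L(\lambda,h)$ for all $h\in\mathcal{K}(\epsilon)$. (ii) The maximization problem admits a unique maximizer $\lambda(h)$ if and only if $h\in\operatorname{int}(\mathcal{K}(\epsilon))=\{h\in\mathbb{H}:\langle x,\phi(h)\rangle>0,\ e(h)<\epsilon^2\}$, and it is given by $$\lambda(h)=\frac{\eta(h)}{\|\phi(h)\|\sqrt{\epsilon^2-e(h)}}\,\bigl(x-\eta(h)\phi(h)\bigr).$$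
   Context: $\mathbb{H}$ is a finite-dimensional real Hilbert space; $\mathbb{R}^n$ carries an inner product $\langle\cdot,\cdot\rangle$ with associated norm $\|\cdot\|$; $\phi:\mathbb{H}\to\mathbb{R}^n$ is linear; $x\in\mathbb{R}^n$, $\epsilon>0$. Standing assumptions. (1) The cost $c:\mathbb{H}\to\mathbb{R}$ is positively homogeneous ($c(rf)=rc(f)$ for all $r\ge0$, $f\in\mathbb{H}$), and $B_c:=\{f\in\mathbb{H}:c(f)\le1\}$ is compact and convex. (2) $\|x\|>\epsilon>0$ and there exists $f\in\mathbb{H}$ with $\|x-\phi(f)\|<\epsilon$. Definitions. $\Lambda:=\{\lambda\in\mathbb{R}^n:\langle\lambda,x\rangle-\epsilon\|\lambda\|>0\}$ and $l(\lambda):=\sqrt{\langle\lambda,x\rangle-\epsilon\|\lambda\|}$ for $\lambda\in\Lambda$. For $h\in\mathbb{H}$, $e(h):=\min_{\theta\in\mathbb{R}}\|x-\theta\phi(h)\|^2$, i.e. $e(h)=\|x\|^2$ if $\phi(h)=0$ and $e(h)=\|x\|^2-|\langle x,\phi(h)\rangle|^2/\|\phi(h)\|^2$ otherwise. $\mathcal{K}(\epsilon):=\{h\in\mathbb{H}:\langle x,\phi(h)\rangle>0,\ e(h)\le\epsilon^2\}$. The function $\eta:\mathcal{K}(\epsilon)\to[0,\infty)$ is $$\eta(h):=\frac{\|x\|^2-\epsilon^2}{\langle x,\phi(h)\rangle+\|\phi(h)\|\sqrt{\epsilon^2-e(h)}}.$$ *)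

theory Defs
  imports "HOL-Analysis.Analysis"
begin

text \<open>
  A finite-dimensional real Hilbert space and $\mathbb{R}^n$ with an arbitrary inner product are
  both rendered as types of class \<^class>\<open>euclidean_space\<close>: the orthonormal basis of this class is
  relative to whatever inner product the type carries, so that no particular inner product is
  singled out. Zero-dimensional spaces, which the class excludes, are impossible under the
  hypotheses \<open>0 < \<epsilon> < norm x\<close> and \<open>norm (x - \<phi> f) < \<epsilon>\<close> of the theorem.
\<close>

definition cost_ball :: "('h::euclidean_space \<Rightarrow> real) \<Rightarrow> 'h set" where
  "cost_ball c = {f. c f \<le> 1}"

definition Lam :: "'b::euclidean_space \<Rightarrow> real \<Rightarrow> 'b set" where
  "Lam x \<epsilon> = {\<mu>. \<mu> \<bullet> x - \<epsilon> * norm \<mu> > 0}"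

definition lfun :: "'b::euclidean_space \<Rightarrow> real \<Rightarrow> 'b \<Rightarrow> real" where
  "lfun x \<epsilon> \<mu> = sqrt (\<mu> \<bullet> x - \<epsilon> * norm \<mu>)"

definition Lagr ::
  "('h::euclidean_space \<Rightarrow> 'b::euclidean_space) \<Rightarrow> 'b \<Rightarrow> real \<Rightarrow> 'b \<Rightarrow> 'h \<Rightarrow> real" where
  "Lagr \<phi> x \<epsilon> \<mu> h = 2 * lfun x \<epsilon> \<mu> - \<mu> \<bullet> \<phi> h"

text \<open>The infimum below is attained; see \<open>err_attained\<close> and the closed form \<open>err_eq\<close>.\<close>

definition err :: "('h::euclidean_space \<Rightarrow> 'b::euclidean_space) \<Rightarrow> 'b \<Rightarrow> 'h \<Rightarrow> real" where
  "err \<phi> x h = (INF \<theta>::real. (norm (x - \<theta> *\<^sub>R \<phi> h))\<^sup>2)"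

definition K :: "('h::euclidean_space \<Rightarrow> 'b::euclidean_space) \<Rightarrow> 'b \<Rightarrow> real \<Rightarrow> 'h set" where
  "K \<phi> x \<epsilon> = {h. x \<bullet> \<phi> h > 0 \<and> err \<phi> x h \<le> \<epsilon>\<^sup>2}"

text \<open>\<open>eta\<close> is meaningful only on \<open>K \<phi> x \<epsilon>\<close>, and \<open>lam_opt\<close> only where moreover
  \<open>err \<phi> x h < \<epsilon>\<^sup>2\<close>.\<close>

definition eta :: "('h::euclidean_space \<Rightarrow> 'b::euclidean_space) \<Rightarrow> 'b \<Rightarrow> real \<Rightarrow> 'h \<Rightarrow> real" where
  "eta \<phi> x \<epsilon> h =
     ((norm x)\<^sup>2 - \<epsilon>\<^sup>2) / (x \<bullet> \<phi> h + norm (\<phi> h) * sqrt (\<epsilon>\<^sup>2 - err \<phi> x h))"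

definition lam_opt :: "('h::euclidean_space \<Rightarrow> 'b::euclidean_space) \<Rightarrow> 'b \<Rightarrow> real \<Rightarrow> 'h \<Rightarrow> 'b" where
  "lam_opt \<phi> x \<epsilon> h =
     (eta \<phi> x \<epsilon> h / (norm (\<phi> h) * sqrt (\<epsilon>\<^sup>2 - err \<phi> x h))) *\<^sub>R (x - eta \<phi> x \<epsilon> h *\<^sub>R \<phi> h)"

lemma norm_diff_scaleR_sq:
  fixes x v :: "'b::euclidean_space"
  assumes "v \<noteq> 0"
  shows "(norm (x - \<theta> *\<^sub>R v))\<^sup>2 =
    ((norm x)\<^sup>2 - \<bar>x \<bullet> v\<bar>\<^sup>2 / (norm v)\<^sup>2) + (norm v)\<^sup>2 * (\<theta> - (x \<bullet> v) / (norm v)\<^sup>2)\<^sup>2"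
proof -
  define n where "n = (norm v)\<^sup>2"
  have n: "n \<noteq> 0" "v \<bullet> v = n" using assms by (simp_all add: n_def dot_square_norm)
  have "(norm (x - \<theta> *\<^sub>R v))\<^sup>2 = (norm x)\<^sup>2 - 2 * \<theta> * (x \<bullet> v) + \<theta>\<^sup>2 * n"
    using n unfolding power2_norm_eq_inner
    by (simp add: inner_diff_left inner_diff_right inner_commute power2_eq_square algebra_simps)
  also have "\<dots> = ((norm x)\<^sup>2 - (x \<bullet> v)\<^sup>2 / n) + n * (\<theta> - (x \<bullet> v) / n)\<^sup>2"
    using n(1) by (simp add: field_simps power2_eq_square)
  finally show ?thesis by (simp add: n_def)
qed

lemma err_attained_eq:
  fixes \<phi> :: "'h::euclidean_space \<Rightarrow> 'b::euclidean_space"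
  shows err_attained: "\<exists>\<theta>. err \<phi> x h = (norm (x - \<theta> *\<^sub>R \<phi> h))\<^sup>2"
    and err_eq: "err \<phi> x h = (if \<phi> h = 0 then (norm x)\<^sup>2
      else (norm x)\<^sup>2 - \<bar>x \<bullet> \<phi> h\<bar>\<^sup>2 / (norm (\<phi> h))\<^sup>2)"
proof -
  define r where "r = (if \<phi> h = 0 then (norm x)\<^sup>2
      else (norm x)\<^sup>2 - \<bar>x \<bullet> \<phi> h\<bar>\<^sup>2 / (norm (\<phi> h))\<^sup>2)"
  define \<theta>0 where "\<theta>0 = (x \<bullet> \<phi> h) / (norm (\<phi> h))\<^sup>2"
  have at: "(norm (x - \<theta>0 *\<^sub>R \<phi> h))\<^sup>2 = r"
    by (cases "\<phi> h = 0") (simp_all add: r_def \<theta>0_def norm_diff_scaleR_sq)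
  have le: "r \<le> (norm (x - \<theta> *\<^sub>R \<phi> h))\<^sup>2" for \<theta>
    by (cases "\<phi> h = 0") (simp_all add: r_def norm_diff_scaleR_sq)
  have "err \<phi> x h = r"
    unfolding err_def by (rule cInf_eq_minimum) (use at le in auto)
  then show "\<exists>\<theta>. err \<phi> x h = (norm (x - \<theta> *\<^sub>R \<phi> h))\<^sup>2"
    and "err \<phi> x h = (if \<phi> h = 0 then (norm x)\<^sup>2
      else (norm x)\<^sup>2 - \<bar>x \<bullet> \<phi> h\<bar>\<^sup>2 / (norm (\<phi> h))\<^sup>2)"
    using at by (metis, simp add: r_def)
qed

end

theory Submission
  imports Defs
begin

text \<open>
  Write \<open>v = \<phi> h\<close> and \<open>\<eta> = eta \<phi> x \<epsilon> h\<close>. For \<open>h\<close> in \<open>K\<close>, \<open>\<eta>\<close> is the smaller root of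
  \<open>\<parallel>x - t v\<parallel> = \<epsilon>\<close>, so \<open>2 l \<eta> \<le> l\<^sup>2 + \<eta>\<^sup>2\<close> and Cauchy--Schwarz applied to
  \<open>\<mu> \<bullet> (x - \<eta> v)\<close> give \<open>Lagr \<le> \<eta>\<close>. Equality forces \<open>\<mu>\<close> to be a multiple of \<open>x - \<eta> v\<close> and
  \<open>l \<mu> = \<eta>\<close>, which is solvable exactly when \<open>err < \<epsilon>\<^sup>2\<close>. In the boundary case the supremum
  is obtained by perturbing \<open>v\<close> to \<open>v + \<delta> x\<close>. Outside \<open>K\<close> there is a ray of \<open>Lam\<close> along which
  \<open>\<mu> \<bullet> v \<le> 0\<close>, and \<open>Lagr\<close> grows along it like a square root.
\<close>

section \<open>The error condition as a discriminant condition\<close>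

text \<open>Clearing the denominator in \<open>err_eq\<close> also removes its case distinction,
  since both sides vanish when \<open>\<phi> h = 0\<close>.\<close>

lemma err_sq_norm:
  fixes \<phi> :: "'h::euclidean_space \<Rightarrow> 'b::euclidean_space"
  shows "(norm (\<phi> h))\<^sup>2 * err \<phi> x h = (norm x)\<^sup>2 * (norm (\<phi> h))\<^sup>2 - (x \<bullet> \<phi> h)\<^sup>2"
  by (simp add: err_eq field_simps)

text \<open>The difference of the two sides is a quarter of the discriminant of \<open>(norm (x - t
  *\<^sub>R \<phi> h))\<^sup>2 = \<epsilon>\<^sup>2\<close>, a quadratic equation in
  \<open>t\<close>. The error bound thus says that the line through \<open>\<phi> h\<close> meets
  the sphere of radius \<epsilon> around \<open>x\<close>, and the strict bound that it crosses
  it.\<close>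

lemma err_le_iff:
  fixes \<phi> :: "'h::euclidean_space \<Rightarrow> 'b::euclidean_space"
  assumes "x \<bullet> \<phi> h > 0"
  shows "err \<phi> x h \<le> \<epsilon>\<^sup>2 \<longleftrightarrow> ((norm x)\<^sup>2 - \<epsilon>\<^sup>2) * (norm (\<phi> h))\<^sup>2 \<le> (x \<bullet> \<phi> h)\<^sup>2"
    and "err \<phi> x h < \<epsilon>\<^sup>2 \<longleftrightarrow> ((norm x)\<^sup>2 - \<epsilon>\<^sup>2) * (norm (\<phi> h))\<^sup>2 < (x \<bullet> \<phi> h)\<^sup>2"
proof -
  have n: "(norm (\<phi> h))\<^sup>2 > 0" using assms by auto
  have "err \<phi> x h \<le> \<epsilon>\<^sup>2 \<longleftrightarrow> (norm (\<phi> h))\<^sup>2 * err \<phi> x h \<le> (norm (\<phi> h))\<^sup>2 * \<epsilon>\<^sup>2"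
    using n by simp
  then show "err \<phi> x h \<le> \<epsilon>\<^sup>2 \<longleftrightarrow> ((norm x)\<^sup>2 - \<epsilon>\<^sup>2) * (norm (\<phi> h))\<^sup>2 \<le> (x \<bullet> \<phi> h)\<^sup>2"
    unfolding err_sq_norm by (auto simp: algebra_simps)
  have "err \<phi> x h < \<epsilon>\<^sup>2 \<longleftrightarrow> (norm (\<phi> h))\<^sup>2 * err \<phi> x h < (norm (\<phi> h))\<^sup>2 * \<epsilon>\<^sup>2"
    using n by simp
  then show "err \<phi> x h < \<epsilon>\<^sup>2 \<longleftrightarrow> ((norm x)\<^sup>2 - \<epsilon>\<^sup>2) * (norm (\<phi> h))\<^sup>2 < (x \<bullet> \<phi> h)\<^sup>2"
    unfolding err_sq_norm by (auto simp: algebra_simps)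
qed

text \<open>Identifies the product in \<open>eta\<close> as the root of the quarter discriminant, an
  expression visibly continuous in \<open>\<phi> h\<close>. No sign condition arises because
  \<open>sqrt\<close> is multiplicative on all reals, with
  \<open>sqrt (- a) = - sqrt a\<close>.\<close>

lemma norm_mult_sqrt_err:
  fixes \<phi> :: "'h::euclidean_space \<Rightarrow> 'b::euclidean_space"
  shows "norm (\<phi> h) * sqrt (\<epsilon>\<^sup>2 - err \<phi> x h) =
    sqrt ((x \<bullet> \<phi> h)\<^sup>2 - ((norm x)\<^sup>2 - \<epsilon>\<^sup>2) * (norm (\<phi> h))\<^sup>2)"
proof -
  have "norm (\<phi> h) * sqrt (\<epsilon>\<^sup>2 - err \<phi> x h) = sqrt ((norm (\<phi> h))\<^sup>2 * (\<epsilon>\<^sup>2 - err \<phi> x h))"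
    by (simp add: real_sqrt_mult)
  then show ?thesis
    by (simp only: right_diff_distrib err_sq_norm) (simp add: algebra_simps)
qed

section \<open>\<open>eta\<close> as a root of the quadratic equation\<close>

text \<open>With \<open>p\<close>, \<open>D\<close> and \<open>v\<close> as in the proof,
  \<open>eta\<close> is the root \<open>(p - D) / (norm v)\<^sup>2\<close> in rationalised form. The
  last two claims give the inner products needed to evaluate \<open>Lagr\<close> on multiples of the
  residual \<open>x - \<eta> *\<^sub>R v\<close>.\<close>

lemma eta_root:
  fixes \<phi> :: "'h::euclidean_space \<Rightarrow> 'b::euclidean_space"
  assumes \<epsilon>: "0 < \<epsilon>" "\<epsilon> < norm x" and h: "h \<in> K \<phi> x \<epsilon>"
  shows "eta \<phi> x \<epsilon> h > 0"
    and "norm (x - eta \<phi> x \<epsilon> h *\<^sub>R \<phi> h) = \<epsilon>"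
    and "(x - eta \<phi> x \<epsilon> h *\<^sub>R \<phi> h) \<bullet> \<phi> h = norm (\<phi> h) * sqrt (\<epsilon>\<^sup>2 - err \<phi> x h)"
    and "(x - eta \<phi> x \<epsilon> h *\<^sub>R \<phi> h) \<bullet> x =
      \<epsilon>\<^sup>2 + eta \<phi> x \<epsilon> h * (norm (\<phi> h) * sqrt (\<epsilon>\<^sup>2 - err \<phi> x h))"
proof -
  define v p D \<eta> where "v = \<phi> h" and "p = x \<bullet> v"
    and "D = norm (\<phi> h) * sqrt (\<epsilon>\<^sup>2 - err \<phi> x h)" and "\<eta> = eta \<phi> x \<epsilon> h"
  have p: "p > 0" and D: "D \<ge> 0" and e: "err \<phi> x h \<le> \<epsilon>\<^sup>2"
    using h by (simp_all add: K_def p_def v_def D_def)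
  have D2: "D\<^sup>2 = p\<^sup>2 - ((norm x)\<^sup>2 - \<epsilon>\<^sup>2) * (norm v)\<^sup>2"
    using p e err_le_iff(1)[of x \<phi> h \<epsilon>] by (simp add: D_def norm_mult_sqrt_err p_def v_def)
  have s: "(norm x)\<^sup>2 - \<epsilon>\<^sup>2 > 0" using \<epsilon> by (simp add: power_strict_mono)
  have \<eta>: "\<eta> * (p + D) = (norm x)\<^sup>2 - \<epsilon>\<^sup>2"
    using p D by (simp add: \<eta>_def eta_def D_def p_def v_def)
  then show "eta \<phi> x \<epsilon> h > 0"
    using s p D unfolding \<eta>_def[symmetric] by (metis add_pos_nonneg zero_less_mult_pos2)
  \<comment> \<open>Undoes the rationalisation: by \<open>D2\<close> the right-hand side is
    \<open>p\<^sup>2 - D\<^sup>2\<close>, and the positive factor \<open>p + D\<close>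
    cancels.\<close>
  have "(p + D) * (\<eta> * (norm v)\<^sup>2) = ((norm x)\<^sup>2 - \<epsilon>\<^sup>2) * (norm v)\<^sup>2"
    by (simp add: \<eta>[symmetric] algebra_simps)
  also have "\<dots> = (p + D) * (p - D)"
    using D2 by (simp add: algebra_simps power2_eq_square)
  finally have nv: "\<eta> * (norm v)\<^sup>2 = p - D"
    using p D by simp
  have "(x - \<eta> *\<^sub>R v) \<bullet> v = p - \<eta> * (norm v)\<^sup>2"
    by (simp add: inner_diff_left p_def dot_square_norm)
  then show wv: "(x - eta \<phi> x \<epsilon> h *\<^sub>R \<phi> h) \<bullet> \<phi> h = norm (\<phi> h) * sqrt (\<epsilon>\<^sup>2 - err \<phi> x h)"
    using nv by (simp add: \<eta>_def v_def D_def)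
  have "(norm (x - \<eta> *\<^sub>R v))\<^sup>2 = (norm x)\<^sup>2 - 2 * \<eta> * p + \<eta> * (\<eta> * (norm v)\<^sup>2)"
    unfolding power2_norm_eq_inner p_def
    by (simp add: inner_diff_left inner_diff_right inner_commute algebra_simps)
  also have "\<dots> = (norm x)\<^sup>2 - \<eta> * (p + D)"
    unfolding nv by (simp add: algebra_simps)
  also have "\<dots> = \<epsilon>\<^sup>2" using \<eta> by simp
  finally show nw: "norm (x - eta \<phi> x \<epsilon> h *\<^sub>R \<phi> h) = \<epsilon>"
    using \<epsilon> by (simp add: \<eta>_def v_def)
  define w where "w = x - \<eta> *\<^sub>R v"
  have "w \<bullet> x = w \<bullet> (w + \<eta> *\<^sub>R v)" by (simp add: w_def)
  also have "\<dots> = \<epsilon>\<^sup>2 + \<eta> * D"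
    using wv nw unfolding inner_add_right dot_square_norm by (simp add: w_def D_def \<eta>_def v_def)
  finally show "(x - eta \<phi> x \<epsilon> h *\<^sub>R \<phi> h) \<bullet> x =
      \<epsilon>\<^sup>2 + eta \<phi> x \<epsilon> h * (norm (\<phi> h) * sqrt (\<epsilon>\<^sup>2 - err \<phi> x h))"
    by (simp add: w_def D_def \<eta>_def v_def)
qed

section \<open>Upper bound and equality case\<close>

text \<open>Completes the square in \<open>2 * \<eta> * l\<close> and replaces
  \<open>l\<^sup>2\<close> by its definition. When \<open>x - \<eta> *\<^sub>R \<phi> h\<close> has
  norm \<epsilon>, both subtracted terms are nonnegative, the second by Cauchy-Schwarz; this serves
  the bound and its equality case alike.\<close>

lemma Lagr_eta_gap:
  fixes \<phi> :: "'h::euclidean_space \<Rightarrow> 'b::euclidean_space"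
  assumes \<mu>: "\<mu> \<in> Lam x \<epsilon>"
  shows "\<eta> * Lagr \<phi> x \<epsilon> \<mu> h =
    \<eta>\<^sup>2 - (lfun x \<epsilon> \<mu> - \<eta>)\<^sup>2 - (\<epsilon> * norm \<mu> - \<mu> \<bullet> (x - \<eta> *\<^sub>R \<phi> h))"
proof -
  have "(lfun x \<epsilon> \<mu>)\<^sup>2 = \<mu> \<bullet> x - \<epsilon> * norm \<mu>"
    using \<mu> by (simp add: lfun_def Lam_def)
  then show ?thesis
    by (simp add: Lagr_def inner_diff_right power2_diff algebra_simps power2_eq_square)
qed

lemma Lagr_le_eta:
  fixes \<phi> :: "'h::euclidean_space \<Rightarrow> 'b::euclidean_space"
  assumes \<epsilon>: "0 < \<epsilon>" "\<epsilon> < norm x" and h: "h \<in> K \<phi> x \<epsilon>" and \<mu>: "\<mu> \<in> Lam x \<epsilon>"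
  shows "Lagr \<phi> x \<epsilon> \<mu> h \<le> eta \<phi> x \<epsilon> h"
proof -
  define \<eta> where "\<eta> = eta \<phi> x \<epsilon> h"
  note r = eta_root[OF \<epsilon> h, folded \<eta>_def]
  have "\<mu> \<bullet> (x - \<eta> *\<^sub>R \<phi> h) \<le> \<epsilon> * norm \<mu>"
    using norm_cauchy_schwarz[of \<mu> "x - \<eta> *\<^sub>R \<phi> h"] r(2) by (simp add: mult.commute)
  then have "\<eta> * Lagr \<phi> x \<epsilon> \<mu> h \<le> \<eta> * \<eta>"
    unfolding Lagr_eta_gap[OF \<mu>] using zero_le_power2[of "lfun x \<epsilon> \<mu> - \<eta>"]
    unfolding power2_eq_square by linarith
  then show ?thesis using r(1) by (simp add: \<eta>_def)
qed

lemma eta_le_Lagr_imp: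
  fixes \<phi> :: "'h::euclidean_space \<Rightarrow> 'b::euclidean_space"
  assumes \<epsilon>: "0 < \<epsilon>" "\<epsilon> < norm x" and h: "h \<in> K \<phi> x \<epsilon>" and \<mu>: "\<mu> \<in> Lam x \<epsilon>"
    and le: "eta \<phi> x \<epsilon> h \<le> Lagr \<phi> x \<epsilon> \<mu> h"
  shows "err \<phi> x h < \<epsilon>\<^sup>2" and "\<mu> = lam_opt \<phi> x \<epsilon> h"
proof -
  define \<eta> w D where "\<eta> = eta \<phi> x \<epsilon> h" and "w = x - \<eta> *\<^sub>R \<phi> h"
    and "D = norm (\<phi> h) * sqrt (\<epsilon>\<^sup>2 - err \<phi> x h)"
  note r = eta_root[OF \<epsilon> h, folded \<eta>_def, folded w_def D_def]
  have CS: "\<mu> \<bullet> w \<le> \<epsilon> * norm \<mu>"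
    using norm_cauchy_schwarz[of \<mu> w] r(2) by (simp add: mult.commute)
  have "\<eta> * \<eta> \<le> \<eta> * Lagr \<phi> x \<epsilon> \<mu> h"
    using le r(1) by (simp add: \<eta>_def)
  \<comment> \<open>Two nonnegative gaps with sum at most zero, so each vanishes: the first fixes
    the length of \<mu>, the second its direction.\<close>
  then have "(lfun x \<epsilon> \<mu> - \<eta>)\<^sup>2 + (\<epsilon> * norm \<mu> - \<mu> \<bullet> w) \<le> 0"
    unfolding Lagr_eta_gap[OF \<mu>] w_def by (simp add: power2_eq_square)
  with CS have l2: "(lfun x \<epsilon> \<mu> - \<eta>)\<^sup>2 = 0" and \<mu>w: "\<mu> \<bullet> w = norm \<mu> * norm w"
    using zero_le_power2[of "lfun x \<epsilon> \<mu> - \<eta>"] unfolding r(2) mult.commute[of "norm \<mu>"]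
    by linarith+
  have "norm \<mu> *\<^sub>R w = \<epsilon> *\<^sub>R \<mu>"
    using norm_cauchy_schwarz_eq[THEN iffD1, OF \<mu>w] r(2) by simp
  then have "(1 / \<epsilon>) *\<^sub>R (norm \<mu> *\<^sub>R w) = \<mu>"
    using \<epsilon>(1) by simp
  then have "\<mu> = (norm \<mu> / \<epsilon>) *\<^sub>R w"
    by simp
  then obtain a where a: "\<mu> = a *\<^sub>R w" "a * \<epsilon> = norm \<mu>"
    using \<epsilon>(1) that[of "norm \<mu> / \<epsilon>"] by simp
  \<comment> \<open>The vanishing square gives \<open>l = \<eta>\<close>. For
    \<open>\<mu> = a *\<^sub>R w\<close> the terms \<open>a * \<epsilon>\<^sup>2\<close> cancel,
    which leaves \<open>a * D = \<eta> > 0\<close>. This determines \<open>a\<close> and excludes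
    \<open>D = 0\<close>, the case \<open>err = \<epsilon>\<^sup>2\<close>.\<close>
  have "\<eta>\<^sup>2 = \<mu> \<bullet> x - \<epsilon> * norm \<mu>"
    using l2 \<mu> by (simp add: lfun_def Lam_def) (metis less_eq_real_def real_sqrt_pow2 diff_gt_0_iff_gt)
  also have "\<dots> = a * (\<eta> * D)"
    unfolding a(2)[symmetric] by (simp add: a(1) r(4) algebra_simps power2_eq_square)
  finally have aD: "a * D = \<eta>"
    using r(1) by (simp add: power2_eq_square)
  then have D: "D \<noteq> 0" using r(1) by auto
  then show "err \<phi> x h < \<epsilon>\<^sup>2"
    using h by (auto simp: D_def K_def)
  have "a = \<eta> / D" using aD D by (simp add: field_simps)
  then show "\<mu> = lam_opt \<phi> x \<epsilon> h"
    by (simp add: lam_opt_def a(1) \<eta>_def w_def D_def)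
qed

text \<open>The factor \<open>\<eta> / D\<close> is chosen so that \<open>l\<^sup>2 = (\<eta> / D) *
  (w \<bullet> x - \<epsilon>\<^sup>2) = \<eta>\<^sup>2\<close>. The linear term is then
  \<open>(\<eta> / D) * D = \<eta>\<close>, and \<open>2 * \<eta> - \<eta>\<close> remains.\<close>

lemma lam_opt_props:
  fixes \<phi> :: "'h::euclidean_space \<Rightarrow> 'b::euclidean_space"
  assumes \<epsilon>: "0 < \<epsilon>" "\<epsilon> < norm x" and p: "x \<bullet> \<phi> h > 0" and e: "err \<phi> x h < \<epsilon>\<^sup>2"
  shows "lam_opt \<phi> x \<epsilon> h \<in> Lam x \<epsilon>"
    and "Lagr \<phi> x \<epsilon> (lam_opt \<phi> x \<epsilon> h) h = eta \<phi> x \<epsilon> h"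
proof -
  have h: "h \<in> K \<phi> x \<epsilon>" using p e by (simp add: K_def)
  define \<eta> w D where "\<eta> = eta \<phi> x \<epsilon> h" and "w = x - \<eta> *\<^sub>R \<phi> h"
    and "D = norm (\<phi> h) * sqrt (\<epsilon>\<^sup>2 - err \<phi> x h)"
  note r = eta_root[OF \<epsilon> h, folded \<eta>_def, folded w_def D_def]
  have D: "D > 0" unfolding D_def using p e by (intro mult_pos_pos) auto
  have L: "lam_opt \<phi> x \<epsilon> h = (\<eta> / D) *\<^sub>R w"
    by (simp add: lam_opt_def \<eta>_def w_def D_def)
  have sq: "((\<eta> / D) *\<^sub>R w) \<bullet> x - \<epsilon> * norm ((\<eta> / D) *\<^sub>R w) = \<eta>\<^sup>2"
    using D r(1,2) by (simp add: r(4) field_simps power2_eq_square)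
  then show "lam_opt \<phi> x \<epsilon> h \<in> Lam x \<epsilon>"
    using r(1) unfolding L Lam_def mem_Collect_eq sq by simp
  have "((\<eta> / D) *\<^sub>R w) \<bullet> \<phi> h = \<eta>" using r(3) D by simp
  then show "Lagr \<phi> x \<epsilon> (lam_opt \<phi> x \<epsilon> h) h = eta \<phi> x \<epsilon> h"
    unfolding L Lagr_def lfun_def sq using r(1) by (simp add: \<eta>_def)
qed

section \<open>The supremum on \<open>K\<close> and outside it\<close>

lemma x_in_Lam:
  assumes "0 < \<epsilon>" "\<epsilon> < norm x"
  shows "x \<in> Lam x \<epsilon>"
proof -
  have "norm x > 0" using assms by linarith
  then have "\<epsilon> * norm x < norm x * norm x" using assms by simp
  then show ?thesis by (simp add: Lam_def dot_square_norm power2_eq_square)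
qed

lemma Lam_inner_pos:
  assumes "0 < \<epsilon>" "\<mu> \<in> Lam x \<epsilon>"
  shows "\<mu> \<bullet> x > 0"
  using assms mult_nonneg_nonneg[of \<epsilon> "norm \<mu>"] unfolding Lam_def
  by (simp del: mult_nonneg_nonneg)

lemma SUP_Lagr_eq_eta:
  fixes \<phi> :: "'h::euclidean_space \<Rightarrow> 'b::euclidean_space"
  assumes \<epsilon>: "0 < \<epsilon>" "\<epsilon> < norm x" and h: "h \<in> K \<phi> x \<epsilon>"
  shows "(SUP \<mu>\<in>Lam x \<epsilon>. ereal (Lagr \<phi> x \<epsilon> \<mu> h)) = ereal (eta \<phi> x \<epsilon> h)" (is "?S = _")
proof (rule antisym)
  show "?S \<le> ereal (eta \<phi> x \<epsilon> h)"
    using Lagr_le_eta[OF \<epsilon> h] by (intro SUP_least) simp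
  \<comment> \<open>A constant map, so \<open>h\<close> is only a dummy argument of it. The
    preceding lemmas hold for arbitrary maps and hence apply to the perturbed vector.\<close>
  define \<psi> :: "real \<Rightarrow> 'h \<Rightarrow> 'b" where "\<psi> \<delta> = (\<lambda>_. \<phi> h + \<delta> *\<^sub>R x)" for \<delta>
  define s where "s = (norm x)\<^sup>2 - \<epsilon>\<^sup>2"
  have s: "s > 0" using \<epsilon> by (simp add: power_strict_mono s_def)
  have p: "x \<bullet> \<phi> h > 0" and e: "err \<phi> x h \<le> \<epsilon>\<^sup>2" using h by (simp_all add: K_def)
  have base: "s * (norm (\<phi> h))\<^sup>2 \<le> (x \<bullet> \<phi> h)\<^sup>2"
    using e err_le_iff(1)[of x \<phi> h \<epsilon>] p by (simp add: s_def)
  have bound: "ereal (eta (\<psi> \<delta>) x \<epsilon> h) \<le> ?S" if \<delta>: "\<delta> > 0" for \<delta>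
  proof -
    define \<mu> where "\<mu> = lam_opt (\<psi> \<delta>) x \<epsilon> h"
    have xx: "x \<bullet> x = s + \<epsilon>\<^sup>2" by (simp add: s_def dot_square_norm)
    have p': "x \<bullet> \<psi> \<delta> h > 0"
      using p \<delta> by (simp add: \<psi>_def inner_add_right add_pos_nonneg)
    \<comment> \<open>Since \<open>x \<bullet> x - s = \<epsilon>\<^sup>2\<close>, moving towards
      \<open>x\<close> strictly increases the discriminant. The perturbed problem is therefore in
      the strict case and has the maximizer \<open>\<mu>\<close>.\<close>
    have "(x \<bullet> \<psi> \<delta> h)\<^sup>2 - s * (norm (\<psi> \<delta> h))\<^sup>2 =
        ((x \<bullet> \<phi> h)\<^sup>2 - s * (norm (\<phi> h))\<^sup>2) + \<epsilon>\<^sup>2 * (2 * \<delta> * (x \<bullet> \<phi> h) + \<delta>\<^sup>2 * (x \<bullet> x))"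
      unfolding power2_norm_eq_inner \<psi>_def
      by (simp add: inner_add_left inner_add_right inner_commute xx power2_eq_square algebra_simps)
    moreover have "\<epsilon>\<^sup>2 * (2 * \<delta> * (x \<bullet> \<phi> h) + \<delta>\<^sup>2 * (x \<bullet> x)) > 0"
      using \<epsilon>(1) \<delta> p by (intro mult_pos_pos add_pos_nonneg) auto
    ultimately have "err (\<psi> \<delta>) x h < \<epsilon>\<^sup>2"
      using base err_le_iff(2)[of x "\<psi> \<delta>" h \<epsilon>] p' by (simp add: s_def)
    note opt = lam_opt_props[where \<phi> = "\<psi> \<delta>", OF \<epsilon> p' this, folded \<mu>_def]
    \<comment> \<open>The perturbation subtracts exactly this quantity from \<open>Lagr\<close>, so
      the perturbed optimal value is a lower bound for the original supremum.\<close>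
    have "\<delta> * (\<mu> \<bullet> x) \<ge> 0" using Lam_inner_pos[OF \<epsilon>(1) opt(1)] \<delta> by simp
    then have "Lagr (\<psi> \<delta>) x \<epsilon> \<mu> h \<le> Lagr \<phi> x \<epsilon> \<mu> h"
      by (simp add: Lagr_def \<psi>_def inner_add_right)
    then have "ereal (eta (\<psi> \<delta>) x \<epsilon> h) \<le> ereal (Lagr \<phi> x \<epsilon> \<mu> h)" using opt(2) by simp
    also have "\<dots> \<le> ?S" using opt(1) by (rule SUP_upper)
    finally show ?thesis .
  qed
  \<comment> \<open>Once \<open>norm_mult_sqrt_err\<close> has eliminated \<open>err\<close>,
    continuity in \<delta> is evident, as the denominator at 0 is at least
    \<open>x \<bullet> \<phi> h > 0\<close>.\<close>
  have "((\<lambda>\<delta>. eta (\<psi> \<delta>) x \<epsilon> h) \<longlongrightarrow> eta (\<psi> 0) x \<epsilon> h) (at_right 0)"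
  proof -
    have "x \<bullet> \<psi> 0 h + norm (\<psi> 0 h) * sqrt (\<epsilon>\<^sup>2 - err (\<psi> 0) x h) \<noteq> 0"
      unfolding norm_mult_sqrt_err using p base by (simp add: \<psi>_def s_def add_pos_nonneg less_imp_neq[symmetric])
    then show ?thesis
      unfolding eta_def norm_mult_sqrt_err unfolding \<psi>_def
      by (intro tendsto_intros) auto
  qed
  moreover have "eta (\<psi> 0) x \<epsilon> h = eta \<phi> x \<epsilon> h"
    by (simp add: eta_def err_def \<psi>_def)
  ultimately have "((\<lambda>\<delta>. ereal (eta (\<psi> \<delta>) x \<epsilon> h)) \<longlongrightarrow> ereal (eta \<phi> x \<epsilon> h)) (at_right 0)"
    by simp
  then show "ereal (eta \<phi> x \<epsilon> h) \<le> ?S"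
    by (rule tendsto_upperbound)
      (auto simp: eventually_at_right_less intro: eventually_mono[OF eventually_at_right_less] bound)
qed

text \<open>If \<open>x \<bullet> \<phi> h \<le> 0\<close>, the vector \<open>x\<close> itself
  serves. Otherwise the residual \<open>w\<close> of projecting \<open>x\<close> onto the line of
  \<open>\<phi> h\<close> does: it is orthogonal to \<open>\<phi> h\<close>, and
  \<open>w \<bullet> x = (norm w)\<^sup>2 > \<epsilon> * norm w\<close> because
  \<open>(norm w)\<^sup>2 = err > \<epsilon>\<^sup>2\<close>.\<close>

lemma exists_Lam_inner_nonpos:
  fixes \<phi> :: "'h::euclidean_space \<Rightarrow> 'b::euclidean_space"
  assumes \<epsilon>: "0 < \<epsilon>" "\<epsilon> < norm x" and h: "h \<notin> K \<phi> x \<epsilon>"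
  shows "\<exists>\<mu>\<in>Lam x \<epsilon>. \<mu> \<bullet> \<phi> h \<le> 0"
proof (cases "x \<bullet> \<phi> h \<le> 0")
  case True
  then show ?thesis using x_in_Lam[OF \<epsilon>] by blast
next
  case False
  define v where "v = \<phi> h"
  define w where "w = x - ((x \<bullet> v) / (norm v)\<^sup>2) *\<^sub>R v"
  have v: "v \<noteq> 0" using False by (auto simp: v_def)
  have wv: "w \<bullet> v = 0"
    using v by (simp add: w_def inner_diff_left dot_square_norm)
  have "(norm w)\<^sup>2 = err \<phi> x h"
    using v unfolding w_def by (simp add: norm_diff_scaleR_sq err_eq v_def)
  then have "\<epsilon>\<^sup>2 < (norm w)\<^sup>2"
    using h False by (simp add: K_def)
  then have "norm w > \<epsilon>"
    by (rule power_less_imp_less_base) simp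
  then have "\<epsilon> * norm w < norm w * norm w" using \<epsilon>(1) by (intro mult_strict_right_mono) auto
  also have "\<dots> = w \<bullet> w" by (simp add: dot_square_norm power2_eq_square)
  also have "\<dots> = w \<bullet> x"
    using wv by (simp add: w_def[THEN arg_cong[where f = "inner w"]] inner_diff_right)
  finally have "w \<in> Lam x \<epsilon>" by (simp add: Lam_def)
  then show ?thesis using wv by (intro bexI[of _ w]) (simp_all add: v_def)
qed

lemma Lagr_unbounded:
  fixes \<phi> :: "'h::euclidean_space \<Rightarrow> 'b::euclidean_space"
  assumes \<epsilon>: "0 < \<epsilon>" "\<epsilon> < norm x" and h: "h \<notin> K \<phi> x \<epsilon>"
  shows "\<exists>\<mu>\<in>Lam x \<epsilon>. Lagr \<phi> x \<epsilon> \<mu> h > B"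
proof -
  obtain \<mu> where \<mu>: "\<mu> \<in> Lam x \<epsilon>" "\<mu> \<bullet> \<phi> h \<le> 0"
    using exists_Lam_inner_nonpos[OF \<epsilon> h] by blast
  define q where "q = lfun x \<epsilon> \<mu>"
  \<comment> \<open>Since \<open>l\<close> is homogeneous of degree 1/2, scaling \<mu> by
    \<open>r\<^sup>2\<close> multiplies \<open>l\<close> by \<open>r\<close>. This \<open>r\<close>
    makes \<open>l\<close> equal to \<open>\<bar>B\<bar> + 1\<close>, while the term subtracted in
    \<open>Lagr\<close> stays nonpositive.\<close>
  define r where "r = (\<bar>B\<bar> + 1) / q"
  have q: "q > 0" using \<mu>(1) by (simp add: q_def lfun_def Lam_def)
  have r: "r > 0" using q by (simp add: r_def)
  have hom: "(r\<^sup>2 *\<^sub>R \<mu>) \<bullet> x - \<epsilon> * norm (r\<^sup>2 *\<^sub>R \<mu>) = r\<^sup>2 * (\<mu> \<bullet> x - \<epsilon> * norm \<mu>)"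
    by (simp add: algebra_simps)
  have "lfun x \<epsilon> (r\<^sup>2 *\<^sub>R \<mu>) = r * q"
    unfolding lfun_def hom q_def using r by (simp add: real_sqrt_mult)
  also have "\<dots> = \<bar>B\<bar> + 1" using q by (simp add: r_def)
  finally have "lfun x \<epsilon> (r\<^sup>2 *\<^sub>R \<mu>) = \<bar>B\<bar> + 1" .
  moreover have "r\<^sup>2 * (\<mu> \<bullet> \<phi> h) \<le> 0" using \<mu>(2) by (simp add: mult_nonneg_nonpos)
  ultimately have "Lagr \<phi> x \<epsilon> (r\<^sup>2 *\<^sub>R \<mu>) h > B"
    by (simp add: Lagr_def)
  moreover have "r\<^sup>2 *\<^sub>R \<mu> \<in> Lam x \<epsilon>"
    using \<mu>(1) r hom by (simp add: Lam_def)
  ultimately show ?thesis by blast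
qed

lemma SUP_Lagr_eq_PInf:
  fixes \<phi> :: "'h::euclidean_space \<Rightarrow> 'b::euclidean_space"
  assumes \<epsilon>: "0 < \<epsilon>" "\<epsilon> < norm x" and h: "h \<notin> K \<phi> x \<epsilon>"
  shows "(SUP \<mu>\<in>Lam x \<epsilon>. ereal (Lagr \<phi> x \<epsilon> \<mu> h)) = \<infinity>"
proof (rule ereal_top)
  fix B :: real
  show "ereal B \<le> (SUP \<mu>\<in>Lam x \<epsilon>. ereal (Lagr \<phi> x \<epsilon> \<mu> h))"
    using Lagr_unbounded[OF \<epsilon> h, of B] by (metis SUP_upper2 ereal_less_eq(3) less_imp_le)
qed

section \<open>The interior of \<open>K\<close>\<close>

text \<open>The strict conditions describe the open convex cone
  \<open>sqrt s * norm (\<phi> h) < x \<bullet> \<phi> h\<close>, and \<open>K\<close> lies in its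
  non-strict version. The feasible \<open>f\<close> lies in the open cone, and a point of the closed
  cone plus a positive multiple of \<open>f\<close> satisfies the strict inequality.\<close>

lemma interior_K:
  fixes \<phi> :: "'h::euclidean_space \<Rightarrow> 'b::euclidean_space"
  assumes \<phi>: "linear \<phi>" and \<epsilon>: "0 < \<epsilon>" "\<epsilon> < norm x"
    and f: "norm (x - \<phi> f) < \<epsilon>"
  shows "interior (K \<phi> x \<epsilon>) = {h. x \<bullet> \<phi> h > 0 \<and> err \<phi> x h < \<epsilon>\<^sup>2}"
proof -
  define s where "s = (norm x)\<^sup>2 - \<epsilon>\<^sup>2"
  have s: "s > 0" using \<epsilon> by (simp add: power_strict_mono s_def)
  have lt_iff: "x \<bullet> \<phi> h > 0 \<and> err \<phi> x h < \<epsilon>\<^sup>2 \<longleftrightarrow> sqrt s * norm (\<phi> h) < x \<bullet> \<phi> h" for h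
  proof (cases "x \<bullet> \<phi> h > 0")
    case True
    have "s * (norm (\<phi> h))\<^sup>2 < (x \<bullet> \<phi> h)\<^sup>2 \<longleftrightarrow> (sqrt s * norm (\<phi> h))\<^sup>2 < (x \<bullet> \<phi> h)\<^sup>2"
      using s by (simp add: power_mult_distrib)
    also have "\<dots> \<longleftrightarrow> sqrt s * norm (\<phi> h) < x \<bullet> \<phi> h"
      using True s by (auto intro: power_less_imp_less_base power_strict_mono)
    finally show ?thesis using True err_le_iff(2)[of x \<phi> h \<epsilon>] by (simp add: s_def)
  next
    case False
    then show ?thesis using s mult_nonneg_nonneg[of "sqrt s" "norm (\<phi> h)"] by (auto simp del: mult_nonneg_nonneg)
  qed
  have K_le: "sqrt s * norm (\<phi> h) \<le> x \<bullet> \<phi> h" if "h \<in> K \<phi> x \<epsilon>" for h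
  proof (rule power2_le_imp_le)
    show "0 \<le> x \<bullet> \<phi> h" using that by (simp add: K_def)
    show "(sqrt s * norm (\<phi> h))\<^sup>2 \<le> (x \<bullet> \<phi> h)\<^sup>2"
      using that s err_le_iff(1)[of x \<phi> h \<epsilon>] by (simp add: K_def power_mult_distrib s_def)
  qed
  let ?U = "{h. sqrt s * norm (\<phi> h) < x \<bullet> \<phi> h}"
  have fU: "sqrt s * norm (\<phi> f) < x \<bullet> \<phi> f"
  proof -
    have "(norm (x - \<phi> f))\<^sup>2 < \<epsilon>\<^sup>2" using f by (simp add: power_strict_mono)
    \<comment> \<open>Expanding the square bounds \<open>2 * (x \<bullet> \<phi> f)\<close> from
      below by a sum, which the arithmetic-geometric mean inequality compares with
      \<open>2 * (sqrt s * norm (\<phi> f))\<close>.\<close>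
    then have "s + (norm (\<phi> f))\<^sup>2 < 2 * (x \<bullet> \<phi> f)"
      unfolding s_def power2_norm_eq_inner
      by (simp add: inner_diff_left inner_diff_right inner_commute)
    moreover have "2 * (sqrt s * norm (\<phi> f)) \<le> s + (norm (\<phi> f))\<^sup>2"
      using sum_squares_bound[of "sqrt s" "norm (\<phi> f)"] s by simp
    ultimately show ?thesis by linarith
  qed
  have cont: "continuous_on UNIV \<phi>"
    using \<phi> by (simp add: linear_continuous_on linear_conv_bounded_linear)
  have "interior (K \<phi> x \<epsilon>) = ?U"
  proof (rule interior_unique)
    show "?U \<subseteq> K \<phi> x \<epsilon>" using lt_iff by (force simp: K_def)
    show "open ?U" by (intro open_Collect_less continuous_intros cont)
    fix T assume T: "T \<subseteq> K \<phi> x \<epsilon>" "open T"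
    show "T \<subseteq> ?U"
    proof
      fix h assume "h \<in> T"
      \<comment> \<open>Openness of \<open>T\<close> allows a small step back from \<open>h\<close>
        along \<open>f\<close> within \<open>K\<close>. Adding \<open>t *\<^sub>R f\<close> again
        turns the non-strict inequality there into a strict one at \<open>h\<close>.\<close>
      have "((\<lambda>t. h - t *\<^sub>R f) \<longlongrightarrow> h - 0 *\<^sub>R f) (at_right 0)"
        by (intro tendsto_intros)
      then have "\<forall>\<^sub>F t in at_right 0. h - t *\<^sub>R f \<in> T"
        using topological_tendstoD[OF _ T(2)] \<open>h \<in> T\<close> by fastforce
      then have "\<forall>\<^sub>F t in at_right 0. h - t *\<^sub>R f \<in> T \<and> t > (0::real)"
        using eventually_at_right_less by (rule eventually_conj)
      then obtain t where t: "h - t *\<^sub>R f \<in> T" "t > 0"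
        using eventually_happens[OF _] by (metis (no_types, lifting) trivial_limit_at_right_real)
      have \<phi>h: "\<phi> h = \<phi> (h - t *\<^sub>R f) + t *\<^sub>R \<phi> f"
        using \<phi> by (simp add: linear_diff linear_scale)
      have "norm (\<phi> h) \<le> norm (\<phi> (h - t *\<^sub>R f)) + t * norm (\<phi> f)"
        using norm_triangle_ineq[of "\<phi> (h - t *\<^sub>R f)" "t *\<^sub>R \<phi> f"] \<phi>h t(2) by simp
      then have "sqrt s * norm (\<phi> h)
          \<le> sqrt s * (norm (\<phi> (h - t *\<^sub>R f)) + t * norm (\<phi> f))"
        using s by simp
      also have "\<dots> = sqrt s * norm (\<phi> (h - t *\<^sub>R f)) + t * (sqrt s * norm (\<phi> f))"
        by (simp add: algebra_simps)
      also have "\<dots> < x \<bullet> \<phi> (h - t *\<^sub>R f) + t * (x \<bullet> \<phi> f)"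
        using K_le[of "h - t *\<^sub>R f"] t T(1) fU by (intro add_le_less_mono) auto
      also have "\<dots> = x \<bullet> \<phi> h" by (simp add: \<phi>h[THEN arg_cong[where f = "inner x"]] inner_add_right)
      finally show "h \<in> ?U" by simp
    qed
  qed
  then show ?thesis using lt_iff by auto
qed

section \<open>Maximizers and conclusion\<close>

text \<open>Unboundedness outside \<open>K\<close> forces \<open>h\<close> into \<open>K\<close>; a
  maximizer then attains the supremum \<open>eta\<close>, and the equality case identifies it. Every
  maximizer being \<open>lam_opt\<close>, existence and unique existence coincide.\<close>

lemma is_arg_max_Lagr_iff:
  fixes \<phi> :: "'h::euclidean_space \<Rightarrow> 'b::euclidean_space"
  assumes \<epsilon>: "0 < \<epsilon>" "\<epsilon> < norm x"
  shows "is_arg_max (\<lambda>\<mu>. Lagr \<phi> x \<epsilon> \<mu> h) (\<lambda>\<mu>. \<mu> \<in> Lam x \<epsilon>) \<mu> \<longleftrightarrow>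
    x \<bullet> \<phi> h > 0 \<and> err \<phi> x h < \<epsilon>\<^sup>2 \<and> \<mu> = lam_opt \<phi> x \<epsilon> h"
proof
  assume "is_arg_max (\<lambda>\<mu>. Lagr \<phi> x \<epsilon> \<mu> h) (\<lambda>\<mu>. \<mu> \<in> Lam x \<epsilon>) \<mu>"
  then have \<mu>: "\<mu> \<in> Lam x \<epsilon>"
    and max: "\<And>\<nu>. \<nu> \<in> Lam x \<epsilon> \<Longrightarrow> Lagr \<phi> x \<epsilon> \<nu> h \<le> Lagr \<phi> x \<epsilon> \<mu> h"
    by (auto simp: is_arg_max_linorder)
  have h: "h \<in> K \<phi> x \<epsilon>"
    using Lagr_unbounded[OF \<epsilon>, of h \<phi> "Lagr \<phi> x \<epsilon> \<mu> h"] max by (meson not_less)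
  have "ereal (eta \<phi> x \<epsilon> h) \<le> ereal (Lagr \<phi> x \<epsilon> \<mu> h)"
    unfolding SUP_Lagr_eq_eta[OF \<epsilon> h, symmetric] using max by (intro SUP_least) simp
  then show "x \<bullet> \<phi> h > 0 \<and> err \<phi> x h < \<epsilon>\<^sup>2 \<and> \<mu> = lam_opt \<phi> x \<epsilon> h"
    using eta_le_Lagr_imp[OF \<epsilon> h \<mu>] h by (simp add: K_def)
next
  assume *: "x \<bullet> \<phi> h > 0 \<and> err \<phi> x h < \<epsilon>\<^sup>2 \<and> \<mu> = lam_opt \<phi> x \<epsilon> h"
  then have "h \<in> K \<phi> x \<epsilon>" by (simp add: K_def)
  then show "is_arg_max (\<lambda>\<mu>. Lagr \<phi> x \<epsilon> \<mu> h) (\<lambda>\<mu>. \<mu> \<in> Lam x \<epsilon>) \<mu>"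
    using * lam_opt_props[where \<phi> = \<phi> and h = h, OF \<epsilon>] Lagr_le_eta[where \<phi> = \<phi> and h = h, OF \<epsilon>]
    by (simp add: is_arg_max_linorder)
qed

theorem proposition5p1:
  fixes c :: "'h::euclidean_space \<Rightarrow> real"
    and \<phi> :: "'h \<Rightarrow> 'b::euclidean_space"
    and x :: 'b and \<epsilon> :: real
  assumes "linear \<phi>"
    and "\<forall>r\<ge>0. \<forall>f. c (r *\<^sub>R f) = r * c f"
    and "compact (cost_ball c)" and "convex (cost_ball c)"
    and "norm x > \<epsilon>" and "\<epsilon> > 0"
    and "\<exists>f. norm (x - \<phi> f) < \<epsilon>"
  shows
    "(\<forall>h\<in>cost_ball c.
        (\<bar>SUP \<mu>\<in>Lam x \<epsilon>. ereal (Lagr \<phi> x \<epsilon> \<mu> h)\<bar> \<noteq> \<infinity> \<longleftrightarrow> h \<in> K \<phi> x \<epsilon>) \<and>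
        ((\<exists>!\<mu>. is_arg_max (\<lambda>\<mu>. Lagr \<phi> x \<epsilon> \<mu> h) (\<lambda>\<mu>. \<mu> \<in> Lam x \<epsilon>) \<mu>)
            \<longleftrightarrow> h \<in> interior (K \<phi> x \<epsilon>)) \<and>
        (h \<in> interior (K \<phi> x \<epsilon>) \<longrightarrow>
            is_arg_max (\<lambda>\<mu>. Lagr \<phi> x \<epsilon> \<mu> h) (\<lambda>\<mu>. \<mu> \<in> Lam x \<epsilon>) (lam_opt \<phi> x \<epsilon> h))) \<and>
     (\<forall>h\<in>K \<phi> x \<epsilon>. (SUP \<mu>\<in>Lam x \<epsilon>. ereal (Lagr \<phi> x \<epsilon> \<mu> h)) = ereal (eta \<phi> x \<epsilon> h)) \<and>
     interior (K \<phi> x \<epsilon>) = {h. x \<bullet> \<phi> h > 0 \<and> err \<phi> x h < \<epsilon>\<^sup>2}"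
proof -
  obtain f where f: "norm (x - \<phi> f) < \<epsilon>" using assms(7) by blast
  note \<epsilon> = \<open>\<epsilon> > 0\<close> \<open>norm x > \<epsilon>\<close>
  note int = interior_K[OF \<open>linear \<phi>\<close> \<epsilon> f]
  \<comment> \<open>The extended-real supremum is either the real number \<open>eta\<close> or
    \<infinity>, so finiteness just separates these two cases.\<close>
  have "\<bar>SUP \<mu>\<in>Lam x \<epsilon>. ereal (Lagr \<phi> x \<epsilon> \<mu> h)\<bar> \<noteq> \<infinity> \<longleftrightarrow> h \<in> K \<phi> x \<epsilon>" for h
    by (cases "h \<in> K \<phi> x \<epsilon>") (simp_all add: SUP_Lagr_eq_eta[OF \<epsilon>] SUP_Lagr_eq_PInf[OF \<epsilon>])
  then show ?thesis
    by (auto simp add: SUP_Lagr_eq_eta[OF \<epsilon>] is_arg_max_Lagr_iff[OF \<epsilon>] int)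
qed

end
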